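(* Let $$e=\sum_{k=0}^\infty\mathcal L_0^kh,\qquad\text{or else}\qquad h=(1-\mathcal L_0)e=\mathcal L_1e$$ (here $\mathcal Mh=h$ and thus $\mathcal Le=e$). Then the $\sigma$-finite measure $\mu=e\cdot\nu$ is $T$-invariant. To any Borel subset $E$ of $\Omega_0=\Omega\setminus\{0^\infty\}$ it assigns the weight $$\mu(E)=\sum_{k\ge0}\rho\big(T^{-k}E\cap D_k\big),$$ where $D_k=\{\tau>k\}=\bigcup_{l>k}A_l$. In particular $\mu(A_k)=\rho(D_{k-1})$.
   Context: Shift and potential. $\Omega=\{0,1\}^{\{0,1,2,\dots\}}$, $T$ is the left shift, $0^\infty=(000\dots)$, $\tau(\omega)=1+\inf\{i\ge 0:\omega_i=1\}$ (with $\inf\emptyset=\infty$), $A_k=\{\omega:\tau(\omega)=k\}$ for $k\ge1$. Let $\Omega_*$ be the set of $\omega\in\Omega$ with infinitely many $1$'s. For $\omega\in\Omega_*$ the times between passages are $\sigma_k(\omega)=\tau\big((T^\tau)^k\omega\big)$, $k\ge 0$, where $T^\tau\omega=T^{\tau(\omega)}\omega$. A potential $V:\Omega\to\mathbb R$ is given, with induced version $W(\omega)=\sum_{k=0}^{\tau(\omega)-1}V(T^k\omega)$, satisfying: (1) $V$ is continuous, $-C_1\le V\le 0$ for some constant $C_1>0$, and $V(0^\infty)=0$; (2) $\sum_{n\ge1}\exp(\sup_{A_n}W)<C_2$ for some constant $C_2$; (3) for some $0<\theta<1$ and $C_3>0$, for all $n\ge1$, $\mathrm{Var}_nW\le C_3\theta^n$,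 where $\mathrm{Var}_nW=\sup\{|W(\omega)-W(\omega')|:\inf\{k\ge0:\sigma_k(\omega)\ne\sigma_k(\omega')\}=n\}$; (4) the limit $\lim_n\frac1n\log\sum_{\omega_0,\dots,\omega_{n-1}}\exp\big(\sup_{\omega'\in\Omega}\sum_{i=0}^{n-1}V(\omega_i\dots\omega_{n-1}\omega')\big)$ exists and equals $0$. Operators and measures. $\varphi=e^V$, $\psi=e^W$ (here $e^{(\cdot)}$ is the exponential). On functions on $\Omega_*$: $(\mathcal L_0f)(\omega)=\varphi(0\omega)f(0\omega)$, $(\mathcal L_1f)(\omega)=\varphi(1\omega)f(1\omega)$, $\mathcal L=\mathcal L_0+\mathcal L_1$. $\mathcal F_\theta$ is the Banach space of bounded complex functions on $\Omega_*$ which are Lipschitz for $d_\theta(\omega,\omega')=\theta^{\inf\{j\ge0:\sigma_j(\omega)\neq\sigma_j(\omega')\}}$, normed by sup norm plus least Lipschitz constant. The operator $(\mathcal Mf)(\omega)=\sum_{n\ge1}\psi(0^{n-1}1\omega)f(0^{n-1}1\omega)$ on $\mathcal F_\theta$ has a unique positive $h\in\mathcal F_\theta$ and Borel probability measure $\nu$ on $\Omega_*$ with $\mathcal Mh=h$, $\mathcal M^*\nu=\nu$ (i.e. $\int\mathcal Mf\,d\nu=\int f\,d\nu$ for all $f \in \mathcal F_\theta$), $\int h\,d\nu=1$. $\rho=h\cdot\nu$ is a $T^\tau$-invariant probability. Measures on $\Omega_*$ are regarded as measures on $\Omega$ giving mass $0$ to $\Omega\setminus\Omega_*$. *)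

theory Defs
  imports "HOL-Probability.Probability_Measure"
begin

(* The full shift {0,1}^{0,1,2,...} is the type nat => bool (0 = False, 1 = True) with the
   library's product topology and Borel sigma-algebra. *)

definition lshift :: "(nat \<Rightarrow> bool) \<Rightarrow> nat \<Rightarrow> bool" where
  "lshift \<omega> = (\<lambda>i. \<omega> (Suc i))"

definition zero_seq :: "nat \<Rightarrow> bool" where
  "zero_seq = (\<lambda>_. False)"

definition prepend :: "bool list \<Rightarrow> (nat \<Rightarrow> bool) \<Rightarrow> nat \<Rightarrow> bool" where
  "prepend w \<omega> = (\<lambda>i. if i < length w then w ! i else \<omega> (i - length w))"

(* In enat the infimum of the empty set is infinity, so tau zero_seq = \<infinity>. *)
definition tau :: "(nat \<Rightarrow> bool) \<Rightarrow> enat" where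
  "tau \<omega> = 1 + Inf (enat ` {i. \<omega> i})"

definition A_set :: "nat \<Rightarrow> (nat \<Rightarrow> bool) set" where
  "A_set k = {\<omega>. tau \<omega> = enat k}"

(* D_set k contains zero_seq, unlike the union of the A_set l over finite l > k; the measures
   considered give that point mass 0. *)
definition D_set :: "nat \<Rightarrow> (nat \<Rightarrow> bool) set" where
  "D_set k = {\<omega>. tau \<omega> > enat k}"

definition Omega_star :: "(nat \<Rightarrow> bool) set" where
  "Omega_star = {\<omega>. infinite {i. \<omega> i}}"

(* T^tau and the passage times are only meaningful on Omega_star. *)
definition shift_tau :: "(nat \<Rightarrow> bool) \<Rightarrow> nat \<Rightarrow> bool" where
  "shift_tau \<omega> = (lshift ^^ the_enat (tau \<omega>)) \<omega>"

definition sigma_time :: "nat \<Rightarrow> (nat \<Rightarrow> bool) \<Rightarrow> enat" where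
  "sigma_time k \<omega> = tau ((shift_tau ^^ k) \<omega>)"

definition sep_time :: "(nat \<Rightarrow> bool) \<Rightarrow> (nat \<Rightarrow> bool) \<Rightarrow> enat" where
  "sep_time \<omega> \<omega>' = Inf (enat ` {k. sigma_time k \<omega> \<noteq> sigma_time k \<omega>'})"

(* theta ^ sep_time, with theta ^ \<infinity> = 0. *)
definition d_theta :: "real \<Rightarrow> (nat \<Rightarrow> bool) \<Rightarrow> (nat \<Rightarrow> bool) \<Rightarrow> real" where
  "d_theta \<theta> \<omega> \<omega>' = (case sep_time \<omega> \<omega>' of enat n \<Rightarrow> \<theta> ^ n | \<infinity> \<Rightarrow> 0)"

(* At zero_seq the index set is infinite and the sum is 0; this is the right value when
   V zero_seq = 0. *)
definition induced :: "((nat \<Rightarrow> bool) \<Rightarrow> real) \<Rightarrow> (nat \<Rightarrow> bool) \<Rightarrow> real" where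
  "induced V \<omega> = (\<Sum>k | enat k < tau \<omega>. V ((lshift ^^ k) \<omega>))"

definition Var :: "nat \<Rightarrow> ((nat \<Rightarrow> bool) \<Rightarrow> real) \<Rightarrow> ereal" where
  "Var n W = Sup {ereal \<bar>W \<omega> - W \<omega>'\<bar> | \<omega> \<omega>'.
     \<omega> \<in> Omega_star \<and> \<omega>' \<in> Omega_star \<and> sep_time \<omega> \<omega>' = enat n}"

definition word_sum :: "((nat \<Rightarrow> bool) \<Rightarrow> real) \<Rightarrow> nat \<Rightarrow> real" where
  "word_sum V n = (\<Sum>w | length w = n. exp (SUP \<omega>'. \<Sum>i<n. V (prepend (drop i w) \<omega>')))"

(* A function on Omega_star is represented by a function on the whole space whose values off
   Omega_star are irrelevant: since Omega_star is invariant under prepending words, the operators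
   below, evaluated at points of Omega_star, only use values on Omega_star. They are polymorphic
   so that they act on real as well as on complex functions. *)

definition F_theta :: "real \<Rightarrow> ((nat \<Rightarrow> bool) \<Rightarrow> complex) set" where
  "F_theta \<theta> = {f. bounded (f ` Omega_star) \<and>
     (\<exists>L. \<forall>\<omega>\<in>Omega_star. \<forall>\<omega>'\<in>Omega_star. norm (f \<omega> - f \<omega>') \<le> L * d_theta \<theta> \<omega> \<omega>')}"

definition L0 :: "((nat \<Rightarrow> bool) \<Rightarrow> real) \<Rightarrow> ((nat \<Rightarrow> bool) \<Rightarrow> 'a::real_normed_vector) \<Rightarrow> (nat \<Rightarrow> bool) \<Rightarrow> 'a" where
  "L0 V f \<omega> = exp (V (prepend [False] \<omega>)) *\<^sub>R f (prepend [False] \<omega>)"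

definition L1 :: "((nat \<Rightarrow> bool) \<Rightarrow> real) \<Rightarrow> ((nat \<Rightarrow> bool) \<Rightarrow> 'a::real_normed_vector) \<Rightarrow> (nat \<Rightarrow> bool) \<Rightarrow> 'a" where
  "L1 V f \<omega> = exp (V (prepend [True] \<omega>)) *\<^sub>R f (prepend [True] \<omega>)"

definition transfer :: "((nat \<Rightarrow> bool) \<Rightarrow> real) \<Rightarrow> ((nat \<Rightarrow> bool) \<Rightarrow> 'a::real_normed_vector) \<Rightarrow> (nat \<Rightarrow> bool) \<Rightarrow> 'a" where
  "transfer V f \<omega> = L0 V f \<omega> + L1 V f \<omega>"

(* The summation index n here is n - 1 in the sum over n \<ge> 1 of psi(0^(n-1) 1 \<omega>) f(0^(n-1) 1 \<omega>). *)
definition M_op :: "((nat \<Rightarrow> bool) \<Rightarrow> real) \<Rightarrow> ((nat \<Rightarrow> bool) \<Rightarrow> 'a::real_normed_vector) \<Rightarrow> (nat \<Rightarrow> bool) \<Rightarrow> 'a" where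
  "M_op V f \<omega> = (\<Sum>n. exp (induced V (prepend (replicate n False @ [True]) \<omega>))
                     *\<^sub>R f (prepend (replicate n False @ [True]) \<omega>))"

definition e_fun :: "((nat \<Rightarrow> bool) \<Rightarrow> real) \<Rightarrow> ((nat \<Rightarrow> bool) \<Rightarrow> real) \<Rightarrow> (nat \<Rightarrow> bool) \<Rightarrow> real" where
  "e_fun V h \<omega> = (\<Sum>k. (L0 V ^^ k) h \<omega>)"

(* The measure f \<cdot> \<nu> for a nonnegative function f on Omega_star, extended to the whole space by
   mass 0 off Omega_star. *)
definition weighted :: "((nat \<Rightarrow> bool) \<Rightarrow> real) \<Rightarrow> (nat \<Rightarrow> bool) measure \<Rightarrow> (nat \<Rightarrow> bool) measure" where
  "weighted f \<nu> = density \<nu> (\<lambda>\<omega>. ennreal (f \<omega>) * indicator Omega_star \<omega>)"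

end

theory Submission
  imports Defs
begin

text \<open>
  Summing over the position of the first 1 gives the identity M f = L1 f + M (L0 f). Since the
  integral of M f against nu is that of f, integrating it shows that nu is also fixed by the
  adjoint of L = L0 + L1, and no cancellation is needed for nonnegative f. Invariance of e nu then
  is the usual computation with L e = e, and applying the relation k times to functions supported
  on D_k, where L1 does not contribute, turns rho(T^{-k} E \<inter> D_k) into the integral over E of
  L0^k h. The eigenmeasure property is only assumed on F_theta; it passes to all nonnegative Borel
  functions because indicators of sets depending on finitely many coordinates lie in F_theta and
  these sets form a pi-system generating the Borel sigma-algebra. On a point 0^m 1 \<omega> the
  series for e is, up to the factor exp (- W), a tail of the series for M h at \<omega>.
\<close>

subsection \<open>Passage times and coordinates\<close>

text \<open>These are the inverse branches of \<open>shift_tau\<close>. The index counts leading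
  zeros, so it is one less than the passage time and agrees with the summation index in
  \<open>M_op\<close>.\<close>

definition gap :: "nat \<Rightarrow> (nat \<Rightarrow> bool) \<Rightarrow> nat \<Rightarrow> bool" where
  "gap n \<omega> = prepend (replicate n False @ [True]) \<omega>"

lemma gap_apply: "gap n \<omega> i = (if i < n then False else if i = n then True else \<omega> (i - Suc n))"
  by (auto simp: gap_def prepend_def nth_append)

lemma prepend_single_apply: "prepend [b] \<omega> i = (case i of 0 \<Rightarrow> b | Suc j \<Rightarrow> \<omega> j)"
  by (auto simp: prepend_def split: nat.splits)

lemma gap_0: "gap 0 \<omega> = prepend [True] \<omega>"
  by (simp add: gap_def)

lemma gap_Suc: "gap (Suc n) \<omega> = prepend [False] (gap n \<omega>)"
  by (rule ext) (auto simp: gap_apply prepend_single_apply split: nat.splits)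

lemma lshift_prepend [simp]: "lshift (prepend [b] \<omega>) = \<omega>"
  by (rule ext) (simp add: lshift_def prepend_single_apply)

lemma funpow_lshift_apply: "(lshift ^^ k) \<omega> i = \<omega> (k + i)"
  by (induction k arbitrary: i) (auto simp: lshift_def)

lemma funpow_lshift_Suc_gap: "(lshift ^^ Suc n) (gap n \<omega>) = \<omega>"
  by (rule ext) (simp add: funpow_lshift_apply gap_apply del: funpow.simps)

text \<open>Cutting at the first 1 exhibits the branch; the sequence without any 1 is the only point
  outside all branches.\<close>

lemma gap_cases:
  obtains (zero) "\<omega> = zero_seq" | (gap) n \<omega>' where "\<omega> = gap n \<omega>'"
proof (cases "\<exists>i. \<omega> i")
  case True
  define n where "n = (LEAST i. \<omega> i)"
  have n: "\<omega> n" "\<And>i. i < n \<Longrightarrow> \<not> \<omega> i"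
    using True unfolding n_def by (auto intro: LeastI_ex dest: not_less_Least)
  have "\<omega> = gap n (\<lambda>i. \<omega> (i + Suc n))"
    by (rule ext) (use n in \<open>auto simp: gap_apply\<close>)
  then show ?thesis by (rule that(2))
qed (auto simp: zero_seq_def fun_eq_iff intro: that(1))

lemma prepend_single_mem_Omega_star [simp]: "prepend [b] \<omega> \<in> Omega_star \<longleftrightarrow> \<omega> \<in> Omega_star"
proof -
  have "{i. prepend [b] \<omega> i} = (if b then {0} else {}) \<union> Suc ` {i. \<omega> i}"
  proof (intro set_eqI)
    show "i \<in> {i. prepend [b] \<omega> i} \<longleftrightarrow> i \<in> (if b then {0} else {}) \<union> Suc ` {i. \<omega> i}" for i
      by (cases i) (auto simp: prepend_single_apply)
  qed
  then show ?thesis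
    by (auto simp: Omega_star_def finite_image_iff)
qed

lemma gap_mem_Omega_star [simp]: "gap n \<omega> \<in> Omega_star \<longleftrightarrow> \<omega> \<in> Omega_star"
  by (induction n) (simp_all add: gap_0 gap_Suc)

lemma Omega_star_gap_cases:
  assumes "\<omega> \<in> Omega_star"
  obtains n \<omega>' where "\<omega> = gap n \<omega>'" "\<omega>' \<in> Omega_star"
proof (cases \<omega> rule: gap_cases)
  case zero
  then show ?thesis using assms by (simp add: Omega_star_def zero_seq_def)
qed (use assms that in auto)

lemma tau_gap [simp]: "tau (gap n \<omega>) = enat (Suc n)"
proof -
  have "Inf (enat ` {i. gap n \<omega> i}) = enat n"
    by (rule Inf_eqI) (auto simp: gap_apply not_less[symmetric] intro: rev_image_eqI)
  then show ?thesis by (simp add: tau_def one_enat_def)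
qed

lemma tau_zero_seq [simp]: "tau zero_seq = \<infinity>"
  by (simp add: tau_def zero_seq_def top_enat_def)

lemma shift_tau_gap [simp]: "shift_tau (gap n \<omega>) = \<omega>"
  by (simp add: shift_tau_def funpow_lshift_Suc_gap del: funpow.simps)

lemma sigma_time_0_gap: "sigma_time 0 (gap n \<omega>) = enat (Suc n)"
  by (simp add: sigma_time_def)

lemma sigma_time_Suc_gap: "sigma_time (Suc k) (gap n \<omega>) = sigma_time k \<omega>"
  by (simp add: sigma_time_def funpow_Suc_right del: funpow.simps)

lemma zero_seq_neq_gap [simp]: "zero_seq \<noteq> gap n \<omega>" "gap n \<omega> \<noteq> zero_seq"
  by (metis tau_gap tau_zero_seq enat.distinct(1))+

lemma gap_eq_imp_eq: "gap n \<omega> = gap m \<omega>' \<Longrightarrow> n = m"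
  by (metis tau_gap enat.inject nat.inject)

lemma mem_D_set_iff: "\<omega> \<in> D_set k \<longleftrightarrow> (\<forall>i<k. \<not> \<omega> i)"
  by (cases \<omega> rule: gap_cases) (auto simp: D_set_def gap_apply zero_seq_def[symmetric] fun_cong[OF zero_seq_def])

lemma A_set_Suc_eq: "A_set (Suc n) = range (gap n)"
proof (intro set_eqI)
  show "\<omega> \<in> A_set (Suc n) \<longleftrightarrow> \<omega> \<in> range (gap n)" for \<omega>
    by (cases \<omega> rule: gap_cases) (auto simp: A_set_def dest: gap_eq_imp_eq)
qed

text \<open>Every passage consumes at least one coordinate, so N passage times fix at least the
  first N coordinates. The induction removes the first block, which both points share.\<close>

lemma sigma_times_eq_imp_coords_eq:
  assumes "\<omega> \<in> Omega_star" "\<omega>' \<in> Omega_star" "\<And>k. k < N \<Longrightarrow> sigma_time k \<omega> = sigma_time k \<omega>'" "i < N"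
  shows "\<omega> i = \<omega>' i"
  using assms
proof (induction N arbitrary: \<omega> \<omega>' i)
  case (Suc N)
  obtain n \<eta> where \<eta>: "\<omega> = gap n \<eta>" "\<eta> \<in> Omega_star"
    using Suc.prems(1) by (rule Omega_star_gap_cases)
  obtain n' \<eta>' where \<eta>': "\<omega>' = gap n' \<eta>'" "\<eta>' \<in> Omega_star"
    using Suc.prems(2) by (rule Omega_star_gap_cases)
  have n: "n = n'"
    using Suc.prems(3)[of 0] by (simp add: \<eta> \<eta>' sigma_time_0_gap)
  have "\<eta> j = \<eta>' j" if "j < N" for j
  proof (rule Suc.IH[OF \<eta>(2) \<eta>'(2) _ that])
    show "sigma_time k \<eta> = sigma_time k \<eta>'" if "k < N" for k
      using Suc.prems(3)[of "Suc k"] that by (simp add: \<eta> \<eta>' sigma_time_Suc_gap)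
  qed
  then show ?case
    using \<open>i < Suc N\<close> by (simp add: \<eta> \<eta>' n gap_apply)
qed simp

text \<open>A converse that is only local: passage times are unbounded, so N depends on
  \<open>\<omega>\<close>. Each induction step adds the length of the first block to the N found for
  the remainder.\<close>

lemma coords_determine_sigma_times:
  assumes "\<omega> \<in> Omega_star"
  shows "\<exists>N. \<forall>\<omega>'. (\<forall>i<N. \<omega>' i = \<omega> i) \<longrightarrow> (\<forall>k<n. sigma_time k \<omega>' = sigma_time k \<omega>)"
  using assms
proof (induction n arbitrary: \<omega>)
  case (Suc n)
  obtain m \<eta> where \<eta>: "\<omega> = gap m \<eta>" "\<eta> \<in> Omega_star"
    using Suc.prems by (rule Omega_star_gap_cases)
  from Suc.IH[OF \<eta>(2)] obtain N
    where N: "\<And>\<omega>' k. (\<forall>i<N. \<omega>' i = \<eta> i) \<Longrightarrow> k < n \<Longrightarrow> sigma_time k \<omega>' = sigma_time k \<eta>"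
    by blast
  show ?case
  proof (intro exI[of _ "Suc m + N"] allI impI)
    fix \<omega>' k
    assume *: "\<forall>i<Suc m + N. \<omega>' i = \<omega> i" and k: "k < Suc n"
    define \<eta>' where "\<eta>' = (\<lambda>i. \<omega>' (i + Suc m))"
    have \<omega>': "\<omega>' = gap m \<eta>'"
      by (rule ext) (use * in \<open>auto simp: gap_apply \<eta> \<eta>'_def\<close>)
    have "\<eta>' i = \<eta> i" if "i < N" for i
      using *[rule_format, of "i + Suc m"] that by (simp add: \<eta> \<eta>'_def gap_apply)
    then show "sigma_time k \<omega>' = sigma_time k \<omega>"
      using k by (cases k) (auto simp: \<omega>' \<eta>(1) sigma_time_0_gap sigma_time_Suc_gap intro: N)
  qed
qed simp

section \<open>Estimates for the distance \<open>d_theta\<close>\<close>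

lemma d_theta_nonneg: "0 \<le> \<theta> \<Longrightarrow> 0 \<le> d_theta \<theta> \<omega> \<omega>'"
  by (auto simp: d_theta_def split: enat.splits)

lemma d_theta_le_power:
  assumes "0 \<le> \<theta>" "\<theta> \<le> 1" "\<And>k. k < n \<Longrightarrow> sigma_time k \<omega> = sigma_time k \<omega>'"
  shows "d_theta \<theta> \<omega> \<omega>' \<le> \<theta> ^ n"
proof -
  have "enat n \<le> sep_time \<omega> \<omega>'"
    unfolding sep_time_def using assms(3) by (intro Inf_greatest) (auto simp: not_less[symmetric])
  then show ?thesis
    using assms(1,2) by (auto simp: d_theta_def power_decreasing split: enat.splits)
qed

text \<open>A disagreement at k makes the separation time finite and at most k, so the distance is a
  power of \<theta> with exponent below n.\<close>

lemma power_le_d_theta: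
  assumes "0 \<le> \<theta>" "\<theta> \<le> 1" "k < n" "sigma_time k \<omega> \<noteq> sigma_time k \<omega>'"
  shows "\<theta> ^ n \<le> d_theta \<theta> \<omega> \<omega>'"
proof -
  have *: "sep_time \<omega> \<omega>' \<le> enat k"
    unfolding sep_time_def using assms(4) by (intro Inf_lower) auto
  then obtain m where m: "sep_time \<omega> \<omega>' = enat m" by (cases "sep_time \<omega> \<omega>'") auto
  with * assms show ?thesis
    by (auto simp: d_theta_def intro!: power_decreasing)
qed

subsection \<open>Sets depending on finitely many coordinates\<close>

text \<open>One implication suffices because agreement on the first N coordinates is symmetric;
  \<open>finite_coord_setsE\<close> recovers the equivalence. Over \<open>bool\<close> these are the
  finite unions of cylinders.\<close>

definition finite_coord_sets :: "(nat \<Rightarrow> 'a) set set" where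
  "finite_coord_sets = {E. \<exists>N. \<forall>\<omega> \<omega>'. (\<forall>i<N. \<omega> i = \<omega>' i) \<longrightarrow> \<omega> \<in> E \<longrightarrow> \<omega>' \<in> E}"

lemma finite_coord_setsE:
  assumes "E \<in> finite_coord_sets"
  obtains N where "\<And>\<omega> \<omega>'. \<forall>i<N. \<omega> i = \<omega>' i \<Longrightarrow> \<omega> \<in> E \<longleftrightarrow> \<omega>' \<in> E"
proof -
  from assms obtain N where *: "\<And>\<omega> \<omega>'. (\<forall>i<N. \<omega> i = \<omega>' i) \<Longrightarrow> \<omega> \<in> E \<Longrightarrow> \<omega>' \<in> E"
    unfolding finite_coord_sets_def by blast
  have "\<omega> \<in> E \<longleftrightarrow> \<omega>' \<in> E" if "\<forall>i<N. \<omega> i = \<omega>' i" for \<omega> \<omega>'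
    using *[OF that] *[of \<omega>' \<omega>] that by auto
  then show ?thesis by (rule that)
qed

lemma Int_stable_finite_coord_sets: "Int_stable finite_coord_sets"
proof (rule Int_stableI)
  fix A B :: "(nat \<Rightarrow> 'a) set"
  assume "A \<in> finite_coord_sets" "B \<in> finite_coord_sets"
  then obtain M N where *: "\<And>\<omega> \<omega>'. (\<forall>i<M. \<omega> i = \<omega>' i) \<Longrightarrow> \<omega> \<in> A \<Longrightarrow> \<omega>' \<in> A"
      "\<And>\<omega> \<omega>'. (\<forall>i<N. \<omega> i = \<omega>' i) \<Longrightarrow> \<omega> \<in> B \<Longrightarrow> \<omega>' \<in> B"
    unfolding finite_coord_sets_def by blast
  show "A \<inter> B \<in> finite_coord_sets"
    unfolding finite_coord_sets_def
  proof (intro CollectI exI[of _ "max M N"] allI impI)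
    fix \<omega> \<omega>' :: "nat \<Rightarrow> 'a"
    assume "\<forall>i<max M N. \<omega> i = \<omega>' i" "\<omega> \<in> A \<inter> B"
    then show "\<omega>' \<in> A \<inter> B" using *[of \<omega> \<omega>'] by auto
  qed
qed

lemma open_coord_cylinder:
  fixes \<omega> :: "nat \<Rightarrow> 'a::discrete_topology"
  shows "open {\<omega>'. \<forall>i<N. \<omega>' i = \<omega> i}"
proof -
  have "{\<omega>'. \<forall>i<N. \<omega>' i = \<omega> i} = (\<Inter>i<N. (\<lambda>\<omega>'. \<omega>' i) -` {\<omega> i})"
    by auto
  also have "open \<dots>"
    by (intro open_INT finite_lessThan ballI open_vimage open_discrete) (simp add: continuous_on_product_coordinates)
  finally show ?thesis .
qed

lemma open_contains_coord_cylinder: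
  fixes \<omega> :: "nat \<Rightarrow> 'a::topological_space"
  assumes "open U" "\<omega> \<in> U"
  shows "\<exists>N. {\<omega>'. \<forall>i<N. \<omega>' i = \<omega> i} \<subseteq> U"
proof -
  obtain X where X: "\<omega> \<in> Pi\<^sub>E UNIV X" "finite {i. X i \<noteq> UNIV}" "Pi\<^sub>E UNIV X \<subseteq> U"
    using product_topology_open_contains_basis[of "\<lambda>_. euclidean" UNIV U \<omega>] assms
    by (auto simp: open_fun_def)
  then obtain N where N: "\<And>i. X i \<noteq> UNIV \<Longrightarrow> i < N"
    using finite_nat_set_iff_bounded by auto
  show ?thesis
  proof (intro exI subsetI)
    fix \<omega>' assume *: "\<omega>' \<in> {\<omega>'. \<forall>i<N. \<omega>' i = \<omega> i}"
    have "\<omega>' i \<in> X i" for i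
      using * N[of i] X(1) by (cases "X i = UNIV") (auto simp: PiE_iff)
    then show "\<omega>' \<in> U" using X(3) by (auto simp: PiE_iff)
  qed
qed

text \<open>Coordinates are discrete, so a set depending on finitely many of them is a union of open
  cylinders. Conversely, an open set is a countable union of such sets.\<close>

lemma sigma_sets_finite_coord_sets:
  "sigma_sets UNIV finite_coord_sets = sets (borel :: (nat \<Rightarrow> 'a::discrete_topology) measure)"
proof (intro equalityI)
  have "open E" if "E \<in> finite_coord_sets" for E :: "(nat \<Rightarrow> 'a) set"
  proof -
    obtain N where N: "\<And>\<omega> \<omega>'. \<forall>i<N. \<omega> i = \<omega>' i \<Longrightarrow> \<omega> \<in> E \<longleftrightarrow> \<omega>' \<in> E"
      using finite_coord_setsE[OF \<open>E \<in> finite_coord_sets\<close>] by blast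
    have "E = (\<Union>\<omega>\<in>E. {\<omega>'. \<forall>i<N. \<omega>' i = \<omega> i})"
      using N by auto
    also have "open \<dots>"
      by (intro open_UN ballI open_coord_cylinder)
    finally show ?thesis .
  qed
  then show "sigma_sets UNIV finite_coord_sets \<subseteq> sets (borel :: (nat \<Rightarrow> 'a) measure)"
    by (simp add: borel_def) (intro sigma_sets_mono', auto)
next
  have "U \<in> sigma_sets UNIV finite_coord_sets" if "open U" for U :: "(nat \<Rightarrow> 'a) set"
  proof -
    \<comment> \<open>The points whose N-cylinder stays inside U. Membership is decided by N
      coordinates, and the union runs over N only, hence is countable for an alphabet of any
      size.\<close>
    let ?B = "\<lambda>N. {\<omega>. {\<omega>'. \<forall>i<N. \<omega>' i = \<omega> i} \<subseteq> U}"
    have "?B N \<in> finite_coord_sets" for N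
      unfolding finite_coord_sets_def by (intro CollectI exI[of _ N]) auto
    moreover have "U = (\<Union>N. ?B N)"
    proof (intro equalityI subsetI)
      show "\<omega> \<in> (\<Union>N. ?B N)" if "\<omega> \<in> U" for \<omega>
        using open_contains_coord_cylinder[OF \<open>open U\<close> that] by simp
    qed auto
    ultimately show ?thesis
      using sigma_sets.Union[of ?B UNIV finite_coord_sets] by (simp add: sigma_sets.Basic)
  qed
  then show "sets (borel :: (nat \<Rightarrow> 'a) measure) \<subseteq> sigma_sets UNIV finite_coord_sets"
    by (simp add: borel_def) (intro sigma_sets_mono, auto)
qed

lemma finite_coord_sets_borel:
  "E \<in> finite_coord_sets \<Longrightarrow> E \<in> sets (borel :: (nat \<Rightarrow> 'a::discrete_topology) measure)"
  unfolding sigma_sets_finite_coord_sets[symmetric] by (rule sigma_sets.Basic)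

text \<open>If the first N passage times agree, so do the N coordinates that decide membership.
  Otherwise the distance is at least \<open>\<theta> ^ N\<close> while the values differ by at most
  1, which gives the Lipschitz constant \<open>inverse (\<theta> ^ N)\<close>.\<close>

lemma indicator_finite_coord_set_F_theta:
  assumes "0 < \<theta>" "\<theta> \<le> 1" and E: "E \<in> finite_coord_sets"
  shows "(\<lambda>\<omega>. complex_of_real (indicator E \<omega>)) \<in> F_theta \<theta>"
proof -
  obtain N where N: "\<And>\<omega> \<omega>'. \<forall>i<N. \<omega> i = \<omega>' i \<Longrightarrow> \<omega> \<in> E \<longleftrightarrow> \<omega>' \<in> E"
    using finite_coord_setsE[OF E] by blast
  have "norm (complex_of_real (indicator E \<omega>) - complex_of_real (indicator E \<omega>'))
      \<le> inverse (\<theta> ^ N) * d_theta \<theta> \<omega> \<omega>'" if "\<omega> \<in> Omega_star" "\<omega>' \<in> Omega_star" for \<omega> \<omega>'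
  proof (cases "\<forall>k<N. sigma_time k \<omega> = sigma_time k \<omega>'")
    case True
    then have "\<omega> \<in> E \<longleftrightarrow> \<omega>' \<in> E"
      using sigma_times_eq_imp_coords_eq[OF that] by (intro N) auto
    then show ?thesis
      using assms d_theta_nonneg[of \<theta> \<omega> \<omega>'] by (simp add: indicator_def)
  next
    case False
    then obtain k where "k < N" "sigma_time k \<omega> \<noteq> sigma_time k \<omega>'" by blast
    then have "\<theta> ^ N \<le> d_theta \<theta> \<omega> \<omega>'"
      using assms by (intro power_le_d_theta) auto
    then have "1 \<le> inverse (\<theta> ^ N) * d_theta \<theta> \<omega> \<omega>'"
      using assms by (simp add: field_simps)
    then show ?thesis
      by (rule order_trans[rotated]) (simp add: indicator_def)
  qed
  moreover have "bounded ((\<lambda>\<omega>. complex_of_real (indicator E \<omega>)) ` Omega_star)"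
    by (rule boundedI[of _ 1]) (auto simp: indicator_def)
  ultimately show ?thesis
    unfolding F_theta_def by blast
qed

text \<open>This will supply Borel measurability of h. Agreement with a fixed point in enough
  coordinates forces equality of many passage times, hence a small \<open>d_theta\<close>.\<close>

lemma F_theta_continuous_on:
  assumes "0 < \<theta>" "\<theta> < 1" "f \<in> F_theta \<theta>"
  shows "continuous_on Omega_star f"
proof -
  obtain L where L: "\<And>\<omega> \<omega>'. \<omega> \<in> Omega_star \<Longrightarrow> \<omega>' \<in> Omega_star \<Longrightarrow>
      norm (f \<omega> - f \<omega>') \<le> L * d_theta \<theta> \<omega> \<omega>'"
    using assms(3) unfolding F_theta_def by blast
  \<comment> \<open>The constant L in \<open>F_theta\<close> carries no sign; K is positive, so that
    \<epsilon> can be divided by it.\<close>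
  define K where "K = max L 1"
  have K: "norm (f \<omega> - f \<omega>') \<le> K * d_theta \<theta> \<omega> \<omega>'" if "\<omega> \<in> Omega_star" "\<omega>' \<in> Omega_star" for \<omega> \<omega>'
    using L[OF that] mult_right_mono[of L K "d_theta \<theta> \<omega> \<omega>'"] assms d_theta_nonneg[of \<theta> \<omega> \<omega>']
    by (simp add: K_def)
  have "(f \<longlongrightarrow> f \<omega>) (at \<omega> within Omega_star)" if \<omega>: "\<omega> \<in> Omega_star" for \<omega>
  proof (rule tendstoI)
    fix \<epsilon> :: real assume "\<epsilon> > 0"
    have "K > 0" by (simp add: K_def)
    obtain n where n: "\<theta> ^ n < \<epsilon> / K"
      using real_arch_pow_inv[of "\<epsilon> / K" \<theta>] \<open>\<epsilon> > 0\<close> \<open>K > 0\<close> assms by auto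
    obtain N where N: "\<And>\<omega>' k. \<forall>i<N. \<omega>' i = \<omega> i \<Longrightarrow> k < n \<Longrightarrow> sigma_time k \<omega>' = sigma_time k \<omega>"
      using coords_determine_sigma_times[OF \<omega>, of n] by blast
    have "dist (f \<omega>') (f \<omega>) < \<epsilon>" if "\<omega>' \<in> Omega_star" "\<forall>i<N. \<omega>' i = \<omega> i" for \<omega>'
    proof -
      have "dist (f \<omega>') (f \<omega>) \<le> K * d_theta \<theta> \<omega>' \<omega>"
        using K[OF that(1) \<omega>] by (simp add: dist_norm)
      also have "\<dots> \<le> K * \<theta> ^ n"
        using assms N[OF that(2)] \<open>K > 0\<close> by (intro mult_left_mono d_theta_le_power) auto
      also have "\<dots> < \<epsilon>"
        using n \<open>K > 0\<close> by (simp add: field_simps)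
      finally show ?thesis .
    qed
    then show "\<forall>\<^sub>F \<omega>' in at \<omega> within Omega_star. dist (f \<omega>') (f \<omega>) < \<epsilon>"
      unfolding eventually_at_topological
      by (intro exI[of _ "{\<omega>'. \<forall>i<N. \<omega>' i = \<omega> i}"]) (auto simp: open_coord_cylinder)
  qed
  then show ?thesis
    by (simp add: continuous_on_def)
qed

section \<open>Borel measurability of the basic sets and maps\<close>

lemma D_set_finite_coord: "D_set k \<in> finite_coord_sets"
  unfolding finite_coord_sets_def by (intro CollectI exI[of _ k]) (auto simp: mem_D_set_iff)

lemma D_set_borel [measurable]: "D_set k \<in> sets borel"
  by (rule finite_coord_sets_borel[OF D_set_finite_coord])

lemma Omega_star_borel [measurable]: "Omega_star \<in> sets borel"
proof -
  have "Omega_star = (\<Inter>m. \<Union>n\<in>{m..}. {\<omega>. \<omega> n})"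
    by (auto simp: Omega_star_def infinite_nat_iff_unbounded_le)
  moreover have "{\<omega>. \<omega> n} \<in> sets borel" for n :: nat
    by (rule finite_coord_sets_borel) (auto simp: finite_coord_sets_def intro!: exI[of _ "Suc n"])
  then have "(\<Inter>m. \<Union>n\<in>{m..}. {\<omega>. \<omega> n}) \<in> sets (borel :: (nat \<Rightarrow> bool) measure)"
    by (intro sets.countable_INT'' sets.countable_UN'') simp_all
  ultimately show ?thesis by simp
qed

lemma continuous_on_prepend_single: "continuous_on UNIV (prepend [b])"
proof (rule continuous_on_coordinatewise_then_product)
  show "continuous_on UNIV (\<lambda>\<omega>. prepend [b] \<omega> i)" for i
    by (cases i) (simp_all add: prepend_single_apply continuous_on_product_coordinates)
qed

lemma measurable_prepend_single [measurable]: "prepend [b] \<in> measurable borel borel"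
  by (rule borel_measurable_continuous_onI[OF continuous_on_prepend_single])

lemma measurable_gap [measurable]: "gap n \<in> measurable borel borel"
proof (induction n)
  case (Suc n)
  have "(\<lambda>\<omega>. prepend [False] (gap n \<omega>)) \<in> measurable borel borel"
    using Suc by measurable
  then show ?case by (simp add: gap_Suc)
qed (simp add: gap_0)

lemma measurable_lshift [measurable]: "lshift \<in> measurable borel borel"
proof -
  have "continuous_on UNIV lshift"
    unfolding lshift_def by (intro continuous_on_coordinatewise_then_product) (simp add: continuous_on_product_coordinates)
  then show ?thesis by (rule borel_measurable_continuous_onI)
qed

lemma measurable_funpow_lshift [measurable]: "lshift ^^ k \<in> measurable borel borel"
  by (induction k) (auto simp: o_def intro: measurable_compose)

subsection \<open>Operators on nonnegative functions\<close>

lemma induced_gap: "induced V (gap n \<omega>) = (\<Sum>k<Suc n. V ((lshift ^^ k) (gap n \<omega>)))"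
  by (simp add: induced_def lessThan_def)

lemma induced_gap_0: "induced V (gap 0 \<omega>) = V (gap 0 \<omega>)"
  by (simp add: induced_gap)

text \<open>Prefixing a 0 lengthens the orbit segment up to the first 1 by one point at its start
  and leaves the rest unchanged.\<close>

lemma induced_gap_Suc: "induced V (gap (Suc n) \<omega>) = V (gap (Suc n) \<omega>) + induced V (gap n \<omega>)"
proof -
  have "(lshift ^^ Suc k) (gap (Suc n) \<omega>) = (lshift ^^ k) (gap n \<omega>)" for k
    by (simp add: gap_Suc funpow_Suc_right del: funpow.simps)
  then show ?thesis
    unfolding induced_gap by (subst sum.lessThan_Suc_shift) (simp del: funpow.simps add: funpow_0)
qed

lemma measurable_induced_gap [measurable]:
  assumes [measurable]: "V \<in> borel_measurable borel"
  shows "(\<lambda>\<omega>. induced V (gap n \<omega>)) \<in> borel_measurable borel"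
proof (induction n)
  case (Suc n)
  note [measurable] = Suc
  show ?case unfolding induced_gap_Suc by measurable
qed (simp add: induced_gap_0)

text \<open>For \<open>False\<close> this is \<open>L0\<close> and for \<open>True\<close> it is
  \<open>L1\<close>, on functions with values in [0,\<infinity>]. There all sums and integrals
  exist, so identities can be proved ahead of any convergence.\<close>

definition nn_pull :: "((nat \<Rightarrow> bool) \<Rightarrow> real) \<Rightarrow> bool \<Rightarrow> ((nat \<Rightarrow> bool) \<Rightarrow> ennreal) \<Rightarrow> (nat \<Rightarrow> bool) \<Rightarrow> ennreal" where
  "nn_pull V b f \<omega> = ennreal (exp (V (prepend [b] \<omega>))) * f (prepend [b] \<omega>)"

definition nn_M_op :: "((nat \<Rightarrow> bool) \<Rightarrow> real) \<Rightarrow> ((nat \<Rightarrow> bool) \<Rightarrow> ennreal) \<Rightarrow> (nat \<Rightarrow> bool) \<Rightarrow> ennreal" where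
  "nn_M_op V f \<omega> = (\<Sum>n. ennreal (exp (induced V (gap n \<omega>))) * f (gap n \<omega>))"

lemma measurable_nn_pull [measurable (raw)]:
  assumes [measurable]: "V \<in> borel_measurable borel" "f \<in> borel_measurable borel"
  shows "nn_pull V b f \<in> borel_measurable borel"
  unfolding nn_pull_def[abs_def] by measurable

lemma measurable_funpow_nn_pull:
  assumes "V \<in> borel_measurable borel" "f \<in> borel_measurable borel"
  shows "(nn_pull V b ^^ k) f \<in> borel_measurable borel"
  by (induction k) (simp_all add: assms measurable_nn_pull)

lemma measurable_nn_M_op [measurable (raw)]:
  assumes [measurable]: "V \<in> borel_measurable borel" "f \<in> borel_measurable borel"
  shows "nn_M_op V f \<in> borel_measurable borel"
  unfolding nn_M_op_def[abs_def] by measurable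

text \<open>The term for n = 0 is the \<open>True\<close> branch. In the term for n + 1,
  \<open>induced_gap_Suc\<close> splits off the factor that \<open>nn_pull V False\<close> puts in
  front of f at \<open>gap n \<omega>\<close>.\<close>

lemma nn_M_op_rec: "nn_M_op V f \<omega> = nn_pull V True f \<omega> + nn_M_op V (nn_pull V False f) \<omega>"
proof -
  have step: "ennreal (exp (induced V (gap (Suc n) \<omega>))) * f (gap (Suc n) \<omega>) =
      ennreal (exp (induced V (gap n \<omega>))) * nn_pull V False f (gap n \<omega>)" for n
    by (simp add: nn_pull_def gap_Suc[symmetric] induced_gap_Suc exp_add ennreal_mult mult_ac)
  have "(\<lambda>n. ennreal (exp (induced V (gap (Suc n) \<omega>))) * f (gap (Suc n) \<omega>)) sums
      nn_M_op V (nn_pull V False f) \<omega>"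
    unfolding step nn_M_op_def by (rule summable_sums) simp
  from sums_Suc[of "\<lambda>n. ennreal (exp (induced V (gap n \<omega>))) * f (gap n \<omega>)", OF this]
  show ?thesis
    using induced_gap_0[of V \<omega>]
    unfolding nn_M_op_def[of V f] by (simp add: sums_iff nn_pull_def gap_0 add.commute)
qed

section \<open>Convergence of the induced operator on bounded functions\<close>

locale shift_potential =
  fixes V :: "(nat \<Rightarrow> bool) \<Rightarrow> real"
  assumes V_borel [measurable]: "V \<in> borel_measurable borel"
    and V_nonpos: "V \<omega> \<le> 0"
    and V_sum: "(\<Sum>n. ennreal (exp (SUP \<omega>\<in>A_set (Suc n). induced V \<omega>))) < \<infinity>"
begin

abbreviation gap_bound :: "nat \<Rightarrow> real" where
  "gap_bound n \<equiv> exp (SUP \<omega>\<in>A_set (Suc n). induced V \<omega>)"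

lemma summable_gap_bound: "summable gap_bound"
  using V_sum by (intro summable_suminf_not_top) auto

lemma exp_induced_gap_le: "exp (induced V (gap n \<omega>)) \<le> gap_bound n"
proof -
  \<comment> \<open>A real \<open>SUP\<close> is a genuine supremum only over a set bounded above;
    here V \<le> 0 provides the bound 0.\<close>
  have "bdd_above (induced V ` A_set (Suc n))"
    by (rule bdd_aboveI[of _ 0]) (auto simp: induced_def intro!: sum_nonpos V_nonpos)
  then show ?thesis
    by (auto simp: A_set_Suc_eq intro!: cSUP_upper2)
qed

text \<open>\<open>gap_bound\<close> majorizes the weights uniformly in \<open>\<omega>\<close>. The
  bound on f is asked only at the branch points, so functions controlled on
  \<open>Omega_star\<close> alone qualify.\<close>

lemma summable_M_op:
  assumes "\<And>n. \<bar>f (gap n \<omega>)\<bar> \<le> B"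
  shows "summable (\<lambda>n. exp (induced V (gap n \<omega>)) * f (gap n \<omega>))"
proof (rule summable_comparison_test'[of "\<lambda>n. gap_bound n * B" 0])
  show "summable (\<lambda>n. gap_bound n * B)"
    by (rule summable_mult2[OF summable_gap_bound])
  have "B \<ge> 0" using assms[of 0] by linarith
  then show "norm (exp (induced V (gap n \<omega>)) * f (gap n \<omega>)) \<le> gap_bound n * B" for n
    by (auto simp: abs_mult intro!: mult_mono exp_induced_gap_le assms)
qed

lemma M_op_eq: "M_op V f \<omega> = (\<Sum>n. exp (induced V (gap n \<omega>)) *\<^sub>R f (gap n \<omega>))"
  by (simp add: M_op_def gap_def)

lemma nn_M_op_ennreal:
  assumes "\<And>n. 0 \<le> f (gap n \<omega>)" "\<And>n. \<bar>f (gap n \<omega>)\<bar> \<le> B"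
  shows "nn_M_op V (\<lambda>\<omega>. ennreal (f \<omega>)) \<omega> = ennreal (M_op V f \<omega>)"
proof -
  have "nn_M_op V (\<lambda>\<omega>. ennreal (f \<omega>)) \<omega> = (\<Sum>n. ennreal (exp (induced V (gap n \<omega>)) * f (gap n \<omega>)))"
    using assms(1) by (simp add: nn_M_op_def ennreal_mult)
  also have "\<dots> = ennreal (M_op V f \<omega>)"
    unfolding M_op_eq using assms using summable_M_op[where f = f and \<omega> = \<omega>, OF assms(2)] by (subst suminf_ennreal2) auto
  finally show ?thesis .
qed

text \<open>The eigenmeasure property speaks of complex functions; this carries it over to real
  ones.\<close>

lemma M_op_of_real:
  assumes "\<And>n. \<bar>f (gap n \<omega>)\<bar> \<le> B"
  shows "M_op V (\<lambda>\<omega>. complex_of_real (f \<omega>)) \<omega> = complex_of_real (M_op V f \<omega>)"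
proof -
  have "complex_of_real (M_op V f \<omega>) =
      (\<Sum>n. complex_of_real (exp (induced V (gap n \<omega>)) * f (gap n \<omega>)))"
    using suminf_of_real[OF summable_M_op[where f = f and \<omega> = \<omega>, OF assms], where 'a=complex] by (simp add: M_op_eq)
  then show ?thesis
    by (simp add: M_op_eq scaleR_conv_of_real)
qed

text \<open>Bounds uniform in \<open>\<omega>\<close>, so that the image of an indicator will be
  integrable for a probability measure.\<close>

lemma M_op_indicator_bounds:
  "0 \<le> M_op V (indicator E :: _ \<Rightarrow> real) \<omega>"
  "M_op V (indicator E :: _ \<Rightarrow> real) \<omega> \<le> suminf gap_bound"
proof -
  have summable: "summable (\<lambda>n. exp (induced V (gap n \<omega>)) * indicator E (gap n \<omega>))"
    by (rule summable_M_op[where B = 1]) (simp add: indicator_def)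
  show "0 \<le> M_op V (indicator E :: _ \<Rightarrow> real) \<omega>"
    unfolding M_op_eq real_scaleR_def by (intro suminf_nonneg summable) simp
  have "exp (induced V (gap n \<omega>)) * indicator E (gap n \<omega>) \<le> gap_bound n" for n
    using mult_mono[OF exp_induced_gap_le, of "indicator E (gap n \<omega>)" 1 n \<omega>] by (simp add: indicator_def)
  then show "M_op V (indicator E :: _ \<Rightarrow> real) \<omega> \<le> suminf gap_bound"
    unfolding M_op_eq real_scaleR_def by (intro suminf_le summable summable_gap_bound) simp
qed

end

subsection \<open>The eigenmeasure\<close>

locale induced_eigenmeasure = shift_potential +
  fixes \<theta> :: real and \<nu> :: "(nat \<Rightarrow> bool) measure"
  assumes \<theta>: "0 < \<theta>" "\<theta> < 1"
    and prob: "prob_space \<nu>"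
    and sets_\<nu> [measurable_cong]: "sets \<nu> = sets borel"
    and \<nu>_star: "emeasure \<nu> (- Omega_star) = 0"
    and \<nu>_eigen: "f \<in> F_theta \<theta> \<Longrightarrow>
      (LINT \<omega>:Omega_star|\<nu>. M_op V f \<omega>) = (LINT \<omega>:Omega_star|\<nu>. f \<omega>)"
begin

sublocale prob_space \<nu> by (rule prob)

lemma space_\<nu> [simp]: "space \<nu> = UNIV"
  using sets_eq_imp_space_eq[OF sets_\<nu>] by simp

lemma AE_Omega_star: "AE \<omega> in \<nu>. \<omega> \<in> Omega_star"
  using \<nu>_star by (intro AE_I[of _ _ "- Omega_star"]) (auto simp: sets_\<nu>)

text \<open>The eigenmeasure property for a complex indicator is moved to real integrals and then,
  both integrands being bounded and nonnegative, to nonnegative integrals. The factor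
  \<open>indicator Omega_star\<close> is 1 almost everywhere.\<close>

lemma nn_integral_M_op_indicator:
  assumes E: "E \<in> finite_coord_sets"
  shows "(\<integral>\<^sup>+\<omega>. nn_M_op V (indicator E) \<omega> \<partial>\<nu>) = emeasure \<nu> E"
proof -
  note [measurable] = finite_coord_sets_borel[OF E]
  let ?m = "M_op V (indicator E :: _ \<Rightarrow> real)"
  have bound: "\<bar>indicator E \<omega> :: real\<bar> \<le> 1" for \<omega> by (simp add: indicator_def)
  have "(\<lambda>\<omega>. complex_of_real (indicator E \<omega>)) \<in> F_theta \<theta>"
    using \<theta> E by (intro indicator_finite_coord_set_F_theta) auto
  from \<nu>_eigen[OF this]
  have "(LINT \<omega>|\<nu>. complex_of_real (indicator Omega_star \<omega> * ?m \<omega>)) =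
      (LINT \<omega>|\<nu>. complex_of_real (indicator Omega_star \<omega> * indicator E \<omega>))"
    by (simp add: set_lebesgue_integral_def M_op_of_real[OF bound] scaleR_conv_of_real)
  then have eq: "(LINT \<omega>|\<nu>. indicator Omega_star \<omega> * ?m \<omega>) =
      (LINT \<omega>|\<nu>. indicator Omega_star \<omega> * indicator E \<omega>)"
    unfolding integral_complex_of_real by simp
  have [measurable]: "?m \<in> borel_measurable borel"
    unfolding M_op_eq[abs_def] by measurable
  have "(\<integral>\<^sup>+\<omega>. nn_M_op V (indicator E) \<omega> \<partial>\<nu>) = (\<integral>\<^sup>+\<omega>. nn_M_op V (\<lambda>\<omega>. ennreal (indicator E \<omega>)) \<omega> \<partial>\<nu>)"
    by (simp add: ennreal_indicator)
  also have "\<dots> = (\<integral>\<^sup>+\<omega>. ennreal (indicator Omega_star \<omega> * ?m \<omega>) \<partial>\<nu>)"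
    using AE_Omega_star by (intro nn_integral_cong_AE) (auto simp: nn_M_op_ennreal[OF _ bound])
  also have "\<dots> = ennreal (LINT \<omega>|\<nu>. indicator Omega_star \<omega> * ?m \<omega>)"
    using M_op_indicator_bounds[of E]
    by (intro nn_integral_eq_integral integrable_const_bound[where B = "suminf gap_bound"])
       (auto simp: indicator_def intro: suminf_nonneg summable_gap_bound)
  also have "\<dots> = (\<integral>\<^sup>+\<omega>. ennreal (indicator Omega_star \<omega> * indicator E \<omega>) \<partial>\<nu>)"
    unfolding eq by (intro nn_integral_eq_integral[symmetric] integrable_const_bound[where B = 1])
      (auto simp: indicator_def)
  also have "\<dots> = (\<integral>\<^sup>+\<omega>. indicator E \<omega> \<partial>\<nu>)"
    using AE_Omega_star by (intro nn_integral_cong_AE) (auto simp: ennreal_indicator)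
  also have "\<dots> = emeasure \<nu> E"
    by simp
  finally show ?thesis .
qed

text \<open>The left side is an integral of f against a measure independent of f. That measure
  agrees with \<nu> on a generating pi-system, hence equals \<nu>.\<close>

lemma nn_integral_nn_M_op:
  assumes [measurable]: "f \<in> borel_measurable borel"
  shows "(\<integral>\<^sup>+\<omega>. nn_M_op V f \<omega> \<partial>\<nu>) = (\<integral>\<^sup>+\<omega>. f \<omega> \<partial>\<nu>)"
proof -
  \<comment> \<open>K is the image of \<nu> under the adjoint of M: the pairs (n, \<omega>) are
    weighted by exp W at \<open>gap n \<omega>\<close> and then mapped to that point.\<close>
  define K where "K = distr (density (count_space UNIV \<Otimes>\<^sub>M \<nu>)
    (\<lambda>(n, \<omega>). ennreal (exp (induced V (gap n \<omega>))))) borel (\<lambda>(n, \<omega>). gap n \<omega>)"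
  have [measurable]: "(\<lambda>(n, \<omega>). ennreal (exp (induced V (gap n \<omega>)))) \<in> borel_measurable (count_space UNIV \<Otimes>\<^sub>M \<nu>)"
    "(\<lambda>(n, \<omega>). gap n \<omega>) \<in> measurable (count_space UNIV \<Otimes>\<^sub>M \<nu>) borel"
    by (rule measurable_pair_measure_countable1; simp)+
  have K: "(\<integral>\<^sup>+\<omega>. g \<omega> \<partial>K) = (\<integral>\<^sup>+\<omega>. nn_M_op V g \<omega> \<partial>\<nu>)" if [measurable]: "g \<in> borel_measurable borel" for g
  proof -
    have "(\<integral>\<^sup>+\<omega>. g \<omega> \<partial>K) =
        (\<integral>\<^sup>+x. (case x of (n, \<omega>) \<Rightarrow> ennreal (exp (induced V (gap n \<omega>))) * g (gap n \<omega>)) \<partial>(count_space UNIV \<Otimes>\<^sub>M \<nu>))"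
      unfolding K_def
      by (subst nn_integral_distr, measurable, subst nn_integral_density)
         (auto intro!: nn_integral_cong simp: split_beta)
    also have "\<dots> = (\<integral>\<^sup>+n. \<integral>\<^sup>+\<omega>. ennreal (exp (induced V (gap n \<omega>))) * g (gap n \<omega>) \<partial>\<nu> \<partial>count_space UNIV)"
      by (subst nn_integral_fst[symmetric]) (auto intro!: measurable_pair_measure_countable1)
    also have "\<dots> = (\<integral>\<^sup>+\<omega>. nn_M_op V g \<omega> \<partial>\<nu>)"
      unfolding nn_M_op_def by (simp add: nn_integral_count_space_nat nn_integral_suminf)
    finally show ?thesis .
  qed
  have "K = \<nu>"
  \<comment> \<open>The whole space is itself in the generator and has finite K-mass, equal to its
    \<nu>-mass, so a constant sequence serves as the exhaustion.\<close>
  proof (rule measure_eqI_generator_eq[where E = finite_coord_sets and \<Omega> = UNIV and A = "\<lambda>_. UNIV"])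
    have eq: "emeasure K E = emeasure \<nu> E" if "E \<in> finite_coord_sets" for E
      using K[of "indicator E"] nn_integral_M_op_indicator[OF that] finite_coord_sets_borel[OF that]
      by (simp add: K_def)
    then show "emeasure K E = emeasure \<nu> E" if "E \<in> finite_coord_sets" for E by (simp add: that)
    have UNIV: "UNIV \<in> finite_coord_sets" by (simp add: finite_coord_sets_def)
    then show "range (\<lambda>_. UNIV) \<subseteq> finite_coord_sets" by auto
    show "emeasure K UNIV \<noteq> \<infinity>" for i :: nat
      using eq[OF UNIV] by simp
  qed (auto simp: Int_stable_finite_coord_sets K_def sets_\<nu> sigma_sets_finite_coord_sets)
  with K[OF assms] show ?thesis by simp
qed

text \<open>Invariance under M is used twice: for f, and after \<open>nn_M_op_rec\<close> for
  \<open>nn_pull V False f\<close>.\<close>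

lemma nn_integral_transfer:
  assumes [measurable]: "f \<in> borel_measurable borel"
  shows "(\<integral>\<^sup>+\<omega>. f \<omega> \<partial>\<nu>) = (\<integral>\<^sup>+\<omega>. nn_pull V True f \<omega> \<partial>\<nu>) + (\<integral>\<^sup>+\<omega>. nn_pull V False f \<omega> \<partial>\<nu>)"
proof -
  have "(\<integral>\<^sup>+\<omega>. f \<omega> \<partial>\<nu>) = (\<integral>\<^sup>+\<omega>. nn_pull V True f \<omega> + nn_M_op V (nn_pull V False f) \<omega> \<partial>\<nu>)"
    unfolding nn_M_op_rec[of V f, symmetric] by (simp add: nn_integral_nn_M_op)
  also have "\<dots> = (\<integral>\<^sup>+\<omega>. nn_pull V True f \<omega> \<partial>\<nu>) + (\<integral>\<^sup>+\<omega>. nn_M_op V (nn_pull V False f) \<omega> \<partial>\<nu>)"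
    by (rule nn_integral_add) measurable
  finally show ?thesis
    by (simp add: nn_integral_nn_M_op)
qed

text \<open>Apply \<open>nn_integral_transfer\<close> once. The \<open>True\<close> branch vanishes
  because its points start with 1 and miss \<open>D_set (Suc k)\<close>; the \<open>False\<close>
  branch is the same problem for k with \<open>nn_pull V False g\<close>. Hence the induction must
  generalize g.\<close>

lemma nn_integral_D_set:
  assumes [measurable]: "E \<in> sets borel" and "g \<in> borel_measurable borel"
  shows "(\<integral>\<^sup>+\<omega>. g \<omega> * indicator ((lshift ^^ k) -` E \<inter> D_set k) \<omega> \<partial>\<nu>) =
    (\<integral>\<^sup>+\<omega>. (nn_pull V False ^^ k) g \<omega> * indicator E \<omega> \<partial>\<nu>)"
  using assms(2)
proof (induction k arbitrary: g)
  case 0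
  then show ?case by (simp add: mem_D_set_iff[abs_def] indicator_def)
next
  case (Suc k)
  note [measurable] = Suc.prems
  let ?F = "\<lambda>k. (lshift ^^ k) -` E \<inter> D_set k"
  have F [measurable]: "?F k \<in> sets borel" for k
    using measurable_sets[OF measurable_funpow_lshift assms(1), of k] by auto
  have "prepend [True] \<omega> \<notin> D_set (Suc k)" for \<omega>
    by (auto simp: mem_D_set_iff prepend_single_apply intro!: exI[of _ 0])
  then have 1: "nn_pull V True (\<lambda>\<omega>. g \<omega> * indicator (?F (Suc k)) \<omega>) \<omega> = 0" for \<omega>
    by (simp add: nn_pull_def)
  have "prepend [False] \<omega> \<in> D_set (Suc k) \<longleftrightarrow> \<omega> \<in> D_set k" for \<omega>
    by (auto simp: mem_D_set_iff prepend_single_apply All_less_Suc2)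
  then have "prepend [False] \<omega> \<in> ?F (Suc k) \<longleftrightarrow> \<omega> \<in> ?F k" for \<omega>
    by (simp add: funpow_Suc_right del: funpow.simps)
  then have 0: "nn_pull V False (\<lambda>\<omega>. g \<omega> * indicator (?F (Suc k)) \<omega>) \<omega> =
      nn_pull V False g \<omega> * indicator (?F k) \<omega>" for \<omega>
    by (simp add: nn_pull_def indicator_def del: funpow.simps)
  have "(\<integral>\<^sup>+\<omega>. g \<omega> * indicator (?F (Suc k)) \<omega> \<partial>\<nu>) = (\<integral>\<^sup>+\<omega>. nn_pull V False g \<omega> * indicator (?F k) \<omega> \<partial>\<nu>)"
    by (subst nn_integral_transfer, measurable) (subst nn_integral_cong[OF 0], subst nn_integral_cong[OF 1], simp)
  also have "\<dots> = (\<integral>\<^sup>+\<omega>. (nn_pull V False ^^ Suc k) g \<omega> * indicator E \<omega> \<partial>\<nu>)"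
    by (subst Suc.IH) (simp_all add: measurable_nn_pull funpow_Suc_right del: funpow.simps)
  finally show ?case .
qed

end

subsection \<open>The invariant density\<close>

lemma zero_seq_notin_Omega_star [simp]: "zero_seq \<notin> Omega_star"
  by (simp add: Omega_star_def zero_seq_def)

lemma funpow_lshift_gap: "j \<le> m \<Longrightarrow> (lshift ^^ j) (gap m \<omega>) = gap (m - j) \<omega>"
  by (rule ext) (auto simp: funpow_lshift_apply gap_apply add.commute)

lemma funpow_lshift_zero_seq [simp]: "(lshift ^^ j) zero_seq = zero_seq"
  by (rule ext) (simp add: funpow_lshift_apply zero_seq_def)

lemma gap_mem_A_set [simp]: "gap m \<omega> \<in> A_set k \<longleftrightarrow> k = Suc m"
  by (auto simp: A_set_def)

lemma zero_seq_notin_A_set [simp]: "zero_seq \<notin> A_set k"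
  by (simp add: A_set_def)

lemma gap_mem_D_set [simp]: "gap m \<omega> \<in> D_set k \<longleftrightarrow> k \<le> m"
  by (simp add: D_set_def less_Suc_eq_le)

lemma funpow_lshift_vimage_A_set:
  "(lshift ^^ j) -` A_set (Suc n) \<inter> D_set j = A_set (Suc (n + j))"
proof (intro set_eqI)
  show "\<omega> \<in> (lshift ^^ j) -` A_set (Suc n) \<inter> D_set j \<longleftrightarrow> \<omega> \<in> A_set (Suc (n + j))" for \<omega>
    by (cases \<omega> rule: gap_cases) (auto simp: funpow_lshift_gap)
qed

lemma UN_A_set_eq_D_set: "(\<Union>j. A_set (Suc (n + j))) = D_set n - {zero_seq}"
proof (intro set_eqI)
  show "\<omega> \<in> (\<Union>j. A_set (Suc (n + j))) \<longleftrightarrow> \<omega> \<in> D_set n - {zero_seq}" for \<omega>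
    by (cases \<omega> rule: gap_cases) (auto simp: le_iff_add)
qed

lemma A_set_borel [measurable]: "A_set (Suc n) \<in> sets borel"
proof -
  have "A_set (Suc n) = D_set n - D_set (Suc n)"
  proof (intro set_eqI)
    show "\<omega> \<in> A_set (Suc n) \<longleftrightarrow> \<omega> \<in> D_set n - D_set (Suc n)" for \<omega>
      by (cases \<omega> rule: gap_cases) (auto simp: D_set_def)
  qed
  then show ?thesis by simp
qed

text \<open>The exponent telescopes: the difference of the induced values is the sum of V over the k
  points obtained by prefixing zeros one at a time.\<close>

lemma funpow_L0_gap:
  "(L0 V ^^ k) f (gap m \<omega>) =
    exp (induced V (gap (m + k) \<omega>) - induced V (gap m \<omega>)) *\<^sub>R f (gap (m + k) \<omega>)"
proof (induction k arbitrary: m)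
  case (Suc k)
  have "(L0 V ^^ Suc k) f (gap m \<omega>) = exp (V (gap (Suc m) \<omega>)) *\<^sub>R (L0 V ^^ k) f (gap (Suc m) \<omega>)"
    by (simp add: L0_def gap_Suc)
  also have "\<dots> = exp (V (gap (Suc m) \<omega>) + (induced V (gap (Suc m + k) \<omega>) - induced V (gap (Suc m) \<omega>)))
      *\<^sub>R f (gap (Suc m + k) \<omega>)"
    by (simp only: Suc.IH exp_add scaleR_scaleR)
  also have "V (gap (Suc m) \<omega>) + (induced V (gap (Suc m + k) \<omega>) - induced V (gap (Suc m) \<omega>)) =
      induced V (gap (m + Suc k) \<omega>) - induced V (gap m \<omega>)"
    using induced_gap_Suc[of V m \<omega>] by simp
  finally show ?case by simp
qed simp

lemma funpow_L0_nonneg: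
  fixes f :: "(nat \<Rightarrow> bool) \<Rightarrow> real"
  assumes "\<And>\<omega>. \<omega> \<in> Omega_star \<Longrightarrow> 0 \<le> f \<omega>" "\<omega> \<in> Omega_star"
  shows "0 \<le> (L0 V ^^ k) f \<omega>"
  using assms(2) by (induction k arbitrary: \<omega>) (simp_all add: assms(1) L0_def)

text \<open>\<open>Omega_star\<close> is invariant under prepending, so the indicator passes through
  each step. \<open>ennreal\<close> cuts negative values to 0, which commutes with the positive
  weights.\<close>

lemma funpow_nn_pull_star:
  "(nn_pull V False ^^ k) (\<lambda>\<omega>. ennreal (f \<omega>) * indicator Omega_star \<omega>) \<omega> =
    ennreal ((L0 V ^^ k) f \<omega>) * indicator Omega_star \<omega>"
proof (induction k arbitrary: \<omega>)
  case (Suc k)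
  have "(nn_pull V False ^^ Suc k) (\<lambda>\<omega>. ennreal (f \<omega>) * indicator Omega_star \<omega>) \<omega> =
      ennreal (exp (V (prepend [False] \<omega>))) *
      (ennreal ((L0 V ^^ k) f (prepend [False] \<omega>)) * indicator Omega_star (prepend [False] \<omega>))"
    by (simp add: nn_pull_def Suc.IH)
  also have "\<dots> = ennreal ((L0 V ^^ Suc k) f \<omega>) * indicator Omega_star \<omega>"
    by (simp add: L0_def ennreal_mult' indicator_def)
  finally show ?case .
qed simp

text \<open>The \<open>L1\<close> equation determines the values at points starting with 1. The
  other equation at a point x then determines the value at 0x from that at x, so induction on the
  number of leading zeros reaches all of \<open>Omega_star\<close>.\<close>

lemma eq_on_star_if_same_L0_L1:
  fixes f g :: "(nat \<Rightarrow> bool) \<Rightarrow> real"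
  assumes "\<And>\<omega>. \<omega> \<in> Omega_star \<Longrightarrow> f \<omega> - L0 V f \<omega> = g \<omega> - L0 V g \<omega>"
    and "\<And>\<omega>. \<omega> \<in> Omega_star \<Longrightarrow> L1 V f \<omega> = L1 V g \<omega>"
    and "\<omega> \<in> Omega_star"
  shows "f \<omega> = g \<omega>"
proof -
  obtain n \<eta> where \<eta>: "\<omega> = gap n \<eta>" "\<eta> \<in> Omega_star"
    using assms(3) by (rule Omega_star_gap_cases)
  have "f (gap n \<eta>) = g (gap n \<eta>)"
  proof (induction n)
    case 0
    show ?case using assms(2)[OF \<eta>(2)] by (simp add: L1_def gap_0)
  next
    case (Suc n)
    show ?case using assms(1)[of "gap n \<eta>"] \<eta>(2) Suc by (simp add: L0_def gap_Suc)
  qed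
  then show ?thesis by (simp add: \<eta>(1))
qed

section \<open>Convergence of the series for e and the equations it satisfies\<close>

context shift_potential
begin

context
  fixes h :: "(nat \<Rightarrow> bool) \<Rightarrow> real" and B :: real
  assumes h_bound: "\<And>\<omega>. \<omega> \<in> Omega_star \<Longrightarrow> \<bar>h \<omega>\<bar> \<le> B"
begin

lemma summable_funpow_L0:
  assumes "\<omega> \<in> Omega_star"
  shows "summable (\<lambda>k. (L0 V ^^ k) h \<omega>)"
proof -
  obtain m \<eta> where \<eta>: "\<omega> = gap m \<eta>" "\<eta> \<in> Omega_star"
    using assms by (rule Omega_star_gap_cases)
  let ?S = "\<lambda>n. exp (induced V (gap n \<eta>)) * h (gap n \<eta>)"
  have "summable ?S"
    using \<eta>(2) by (intro summable_M_op[where B = B]) (simp add: h_bound)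
  then have "summable (\<lambda>k. exp (- induced V (gap m \<eta>)) * ?S (k + m))"
    by (intro summable_mult summable_ignore_initial_segment)
  also have "(\<lambda>k. exp (- induced V (gap m \<eta>)) * ?S (k + m)) = (\<lambda>k. (L0 V ^^ k) h \<omega>)"
    by (rule ext) (simp add: \<eta>(1) funpow_L0_gap exp_diff exp_minus field_simps)
  finally show ?thesis .
qed

text \<open>The series also converges at 0\<omega>, so \<open>L0\<close> may be applied termwise;
  the result is the series for e without its first term h.\<close>

lemma e_fun_minus_L0:
  assumes "\<omega> \<in> Omega_star"
  shows "e_fun V h \<omega> - L0 V (e_fun V h) \<omega> = h \<omega>"
proof -
  have "L0 V (e_fun V h) \<omega> = (\<Sum>k. (L0 V ^^ Suc k) h \<omega>)"
    using summable_funpow_L0[of "prepend [False] \<omega>"] assms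
    by (simp add: L0_def e_fun_def suminf_mult)
  then show ?thesis
    using suminf_split_head[OF summable_funpow_L0[OF assms]] by (simp add: e_fun_def)
qed

text \<open>At \<open>gap 0 \<omega>\<close> induced and original potential coincide, so the factor
  of \<open>L1\<close> cancels the subtracted term in \<open>funpow_L0_gap\<close> and the k-th term
  of e becomes the k-th term of M h.\<close>

lemma L1_e_fun:
  assumes "\<omega> \<in> Omega_star"
  shows "L1 V (e_fun V h) \<omega> = M_op V h \<omega>"
proof -
  have "exp (V (gap 0 \<omega>)) * (L0 V ^^ k) h (gap 0 \<omega>) = exp (induced V (gap k \<omega>)) * h (gap k \<omega>)" for k
    by (simp add: funpow_L0_gap induced_gap_0 exp_diff)
  then show ?thesis
    using suminf_mult[OF summable_funpow_L0[of "gap 0 \<omega>"], of "exp (V (gap 0 \<omega>))"] assms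
    by (simp add: L1_def e_fun_def M_op_eq gap_0)
qed

end

end

section \<open>Measures with a density on \<open>Omega_star\<close> and their invariance\<close>

context induced_eigenmeasure
begin

lemma emeasure_weighted:
  assumes "(\<lambda>\<omega>. ennreal (f \<omega>) * indicator Omega_star \<omega>) \<in> borel_measurable borel" "E \<in> sets borel"
  shows "emeasure (weighted f \<nu>) E = (\<integral>\<^sup>+\<omega>. ennreal (f \<omega>) * indicator Omega_star \<omega> * indicator E \<omega> \<partial>\<nu>)"
  unfolding weighted_def using assms by (subst emeasure_density) (auto simp: sets_\<nu> cong: measurable_cong_sets)

text \<open>Over the finite measure \<nu> it suffices that the density is finite almost everywhere,
  and \<open>ennreal (f \<omega>)\<close> is finite as the image of a real, whatever its
  integral.\<close>

lemma sigma_finite_weighted: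
  assumes "(\<lambda>\<omega>. ennreal (f \<omega>) * indicator Omega_star \<omega>) \<in> borel_measurable borel"
  shows "sigma_finite_measure (weighted f \<nu>)"
  unfolding weighted_def using assms
  by (subst sigma_finite_iff_density_finite) (auto simp: ennreal_mult_eq_top_iff indicator_def cong: measurable_cong_sets)

lemma weighted_transfer_invariant:
  assumes [measurable]: "(\<lambda>\<omega>. ennreal (f \<omega>) * indicator Omega_star \<omega>) \<in> borel_measurable borel"
    and nonneg: "\<And>\<omega>. \<omega> \<in> Omega_star \<Longrightarrow> 0 \<le> f \<omega>"
    and fixpoint: "\<And>\<omega>. \<omega> \<in> Omega_star \<Longrightarrow> transfer V f \<omega> = f \<omega>"
    and [measurable]: "E \<in> sets borel"
  shows "emeasure (weighted f \<nu>) (lshift -` E) = emeasure (weighted f \<nu>) E"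
proof -
  define F where "F = (\<lambda>\<omega>. ennreal (f \<omega>) * indicator Omega_star \<omega>)"
  have [measurable]: "F \<in> borel_measurable borel" unfolding F_def by measurable
  have TE [measurable]: "lshift -` E \<in> sets borel"
    using measurable_sets[OF measurable_lshift \<open>E \<in> sets borel\<close>] by simp
  \<comment> \<open>Shifting undoes prepending, so a factor composed with \<open>lshift\<close> can
    be taken out of either branch.\<close>
  have pull: "nn_pull V b (\<lambda>\<omega>. F \<omega> * indicator (lshift -` E) \<omega>) \<omega> = nn_pull V b F \<omega> * indicator E \<omega>" for b \<omega>
    by (simp add: nn_pull_def indicator_def)
  \<comment> \<open>The fixed point equation is lifted to [0,\<infinity>] and to the whole space;
    off \<open>Omega_star\<close> both sides are 0.\<close>
  have fix_F: "nn_pull V True F \<omega> + nn_pull V False F \<omega> = F \<omega>" for \<omega>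
  proof (cases "\<omega> \<in> Omega_star")
    case True
    have "nn_pull V b F \<omega> = ennreal (exp (V (prepend [b] \<omega>)) * f (prepend [b] \<omega>))" for b
      using True by (simp add: nn_pull_def F_def ennreal_mult')
    moreover have "0 \<le> f (prepend [b] \<omega>)" for b
      using True by (intro nonneg) simp
    ultimately show ?thesis
      using fixpoint[OF True] True
      by (simp add: F_def transfer_def L0_def L1_def add.commute flip: ennreal_plus)
  qed (simp add: nn_pull_def F_def)
  have "emeasure (weighted f \<nu>) (lshift -` E) = (\<integral>\<^sup>+\<omega>. F \<omega> * indicator (lshift -` E) \<omega> \<partial>\<nu>)"
    unfolding F_def by (rule emeasure_weighted) measurable
  also have "\<dots> = (\<integral>\<^sup>+\<omega>. nn_pull V True F \<omega> * indicator E \<omega> \<partial>\<nu>) + (\<integral>\<^sup>+\<omega>. nn_pull V False F \<omega> * indicator E \<omega> \<partial>\<nu>)"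
    by (subst nn_integral_transfer, measurable) (subst (1 2) nn_integral_cong[OF pull], rule refl)
  also have "\<dots> = (\<integral>\<^sup>+\<omega>. (nn_pull V True F \<omega> + nn_pull V False F \<omega>) * indicator E \<omega> \<partial>\<nu>)"
    unfolding distrib_right by (rule nn_integral_add[symmetric]) measurable
  also have "\<dots> = emeasure (weighted f \<nu>) E"
    unfolding fix_F unfolding F_def by (rule emeasure_weighted[symmetric]) measurable
  finally show ?thesis .
qed

end

theorem proposition4:
  fixes V :: "(nat \<Rightarrow> bool) \<Rightarrow> real"
    and C1 C2 C3 \<theta> :: real
    and h :: "(nat \<Rightarrow> bool) \<Rightarrow> real"
    and \<nu> \<rho> \<mu> :: "(nat \<Rightarrow> bool) measure"
    and e :: "(nat \<Rightarrow> bool) \<Rightarrow> real"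
  assumes V_cont: "continuous_on UNIV V"
    and C1: "C1 > 0"
    and V_bounds: "\<And>\<omega>. - C1 \<le> V \<omega> \<and> V \<omega> \<le> 0"
    and V_zero: "V zero_seq = 0"
    and V_sum: "(\<Sum>n. ennreal (exp (SUP \<omega>\<in>A_set (Suc n). induced V \<omega>))) < ennreal C2"
    and \<theta>: "0 < \<theta>" "\<theta> < 1"
    and C3: "C3 > 0"
    and V_var: "\<And>n. n \<ge> 1 \<Longrightarrow> Var n (induced V) \<le> ereal (C3 * \<theta> ^ n)"
    and V_pressure: "(\<lambda>n. 1 / real n * ln (word_sum V n)) \<longlonglongrightarrow> 0"
    and h_F: "(\<lambda>\<omega>. complex_of_real (h \<omega>)) \<in> F_theta \<theta>"
    and h_pos: "\<And>\<omega>. \<omega> \<in> Omega_star \<Longrightarrow> h \<omega> > 0"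
    and h_eigen: "\<And>\<omega>. \<omega> \<in> Omega_star \<Longrightarrow> M_op V h \<omega> = h \<omega>"
    and \<nu>_prob: "prob_space \<nu>"
    and \<nu>_borel: "sets \<nu> = sets borel"
    and \<nu>_star: "emeasure \<nu> (- Omega_star) = 0"
    and \<nu>_eigen: "\<And>f. f \<in> F_theta \<theta> \<Longrightarrow>
      (LINT \<omega>:Omega_star|\<nu>. M_op V f \<omega>) = (LINT \<omega>:Omega_star|\<nu>. f \<omega>)"
    and h_normalized: "(LINT \<omega>:Omega_star|\<nu>. h \<omega>) = 1"
  defines "\<rho> \<equiv> weighted h \<nu>"
    and "e \<equiv> e_fun V h"
    and "\<mu> \<equiv> weighted e \<nu>"
  shows "(\<forall>\<omega>\<in>Omega_star. summable (\<lambda>k. (L0 V ^^ k) h \<omega>))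
    \<and> (\<forall>\<omega>\<in>Omega_star. h \<omega> = e \<omega> - L0 V e \<omega> \<and> h \<omega> = L1 V e \<omega>)
    \<and> (\<forall>f. (\<forall>\<omega>\<in>Omega_star. h \<omega> = f \<omega> - L0 V f \<omega> \<and> h \<omega> = L1 V f \<omega>)
          \<longrightarrow> (\<forall>\<omega>\<in>Omega_star. f \<omega> = e \<omega>))
    \<and> (\<forall>\<omega>\<in>Omega_star. transfer V e \<omega> = e \<omega>)
    \<and> sigma_finite_measure \<mu>
    \<and> (\<forall>E\<in>sets borel. emeasure \<mu> (lshift -` E) = emeasure \<mu> E)
    \<and> (\<forall>E\<in>sets borel. E \<subseteq> UNIV - {zero_seq} \<longrightarrow>
          emeasure \<mu> E = (\<Sum>k. emeasure \<rho> ((lshift ^^ k) -` E \<inter> D_set k)))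
    \<and> (\<forall>k\<ge>1. emeasure \<mu> (A_set k) = emeasure \<rho> (D_set (k - 1)))"
proof -
  interpret induced_eigenmeasure V \<theta> \<nu>
  proof (intro induced_eigenmeasure.intro shift_potential.intro induced_eigenmeasure_axioms.intro)
    show "V \<in> borel_measurable borel"
      using V_cont by (rule borel_measurable_continuous_onI)
    show "(\<Sum>n. ennreal (exp (SUP \<omega>\<in>A_set (Suc n). induced V \<omega>))) < \<infinity>"
      using V_sum ennreal_less_top by (simp only: infinity_ennreal_def) (rule less_trans)
  qed (use V_bounds \<theta> \<nu>_prob \<nu>_borel \<nu>_star \<nu>_eigen in auto)

  obtain B where h_bound: "\<And>\<omega>. \<omega> \<in> Omega_star \<Longrightarrow> \<bar>h \<omega>\<bar> \<le> B"
    using h_F unfolding F_theta_def bounded_iff by auto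
  have summable: "summable (\<lambda>k. (L0 V ^^ k) h \<omega>)" if "\<omega> \<in> Omega_star" for \<omega>
    using h_bound that by (rule summable_funpow_L0)
  have e_L0: "e \<omega> - L0 V e \<omega> = h \<omega>" if "\<omega> \<in> Omega_star" for \<omega>
    unfolding e_def using h_bound that by (rule e_fun_minus_L0)
  have e_L1: "L1 V e \<omega> = h \<omega>" if "\<omega> \<in> Omega_star" for \<omega>
    unfolding e_def h_eigen[OF that, symmetric] using h_bound that by (rule L1_e_fun)
  have e_transfer: "transfer V e \<omega> = e \<omega>" if "\<omega> \<in> Omega_star" for \<omega>
    using e_L0[OF that] e_L1[OF that] by (simp add: transfer_def)
  \<comment> \<open>This makes the two descriptions of e interchangeable: any solution of both
    equations is the sum of the series on \<open>Omega_star\<close>.\<close>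
  have unique: "f \<omega> = e \<omega>"
    if "\<forall>\<omega>\<in>Omega_star. h \<omega> = f \<omega> - L0 V f \<omega> \<and> h \<omega> = L1 V f \<omega>" "\<omega> \<in> Omega_star" for f \<omega>
    using that(2) by (rule eq_on_star_if_same_L0_L1[where V = V, rotated 2]) (use that(1) e_L0 e_L1 in auto)

  define H where "H = (\<lambda>\<omega>. ennreal (h \<omega>) * indicator Omega_star \<omega>)"
  \<comment> \<open>Continuity in the relative topology of the Borel set \<open>Omega_star\<close>
    makes the extension of h by 0 Borel.\<close>
  have "continuous_on Omega_star h"
    using continuous_on_Re[OF F_theta_continuous_on[OF \<theta> h_F]] by simp
  then have "(\<lambda>\<omega>. ennreal (indicator Omega_star \<omega> *\<^sub>R h \<omega>)) \<in> borel_measurable borel"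
    by (intro measurable_compose[OF _ measurable_ennreal] borel_measurable_continuous_on_indicator Omega_star_borel)
  also have "(\<lambda>\<omega>. ennreal (indicator Omega_star \<omega> *\<^sub>R h \<omega>)) = H"
    by (auto simp: H_def indicator_def)
  finally have H [measurable]: "H \<in> borel_measurable borel" .
  have pow_nonneg: "0 \<le> (L0 V ^^ k) h \<omega>" if "\<omega> \<in> Omega_star" for k \<omega>
    using that by (rule funpow_L0_nonneg[rotated]) (rule less_imp_le[OF h_pos])
  have e_nonneg: "0 \<le> e \<omega>" if "\<omega> \<in> Omega_star" for \<omega>
    unfolding e_def e_fun_def using that by (intro suminf_nonneg summable pow_nonneg)
  \<comment> \<open>All terms are nonnegative, so \<open>ennreal\<close> may be moved inside the
    convergent sum. This series yields both the measurability of e and the termwise integration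
    below.\<close>
  have e_eq: "ennreal (e \<omega>) * indicator Omega_star \<omega> = (\<Sum>k. (nn_pull V False ^^ k) H \<omega>)" for \<omega>
    using summable[of \<omega>] pow_nonneg[of \<omega>]
    by (cases "\<omega> \<in> Omega_star")
      (simp_all add: H_def funpow_nn_pull_star e_def e_fun_def suminf_ennreal2)
  have pow_measurable [measurable]: "(nn_pull V False ^^ k) H \<in> borel_measurable borel" for k
    by (rule measurable_funpow_nn_pull) measurable
  have e_measurable: "(\<lambda>\<omega>. ennreal (e \<omega>) * indicator Omega_star \<omega>) \<in> borel_measurable borel"
    unfolding e_eq by measurable
  have \<rho>_eq: "emeasure \<rho> E = (\<integral>\<^sup>+\<omega>. H \<omega> * indicator E \<omega> \<partial>\<nu>)" if "E \<in> sets borel" for E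
    unfolding \<rho>_def H_def using H that by (intro emeasure_weighted) (simp_all add: H_def)

  have \<mu>_eq: "emeasure \<mu> E = (\<Sum>k. emeasure \<rho> ((lshift ^^ k) -` E \<inter> D_set k))"
    if [measurable]: "E \<in> sets borel" for E
  proof -
    have "emeasure \<mu> E = (\<integral>\<^sup>+\<omega>. (\<Sum>k. (nn_pull V False ^^ k) H \<omega> * indicator E \<omega>) \<partial>\<nu>)"
      unfolding \<mu>_def by (subst emeasure_weighted[OF e_measurable that]) (simp add: e_eq)
    also have "\<dots> = (\<Sum>k. \<integral>\<^sup>+\<omega>. (nn_pull V False ^^ k) H \<omega> * indicator E \<omega> \<partial>\<nu>)"
      by (rule nn_integral_suminf) measurable
    also have "\<dots> = (\<Sum>k. emeasure \<rho> ((lshift ^^ k) -` E \<inter> D_set k))"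
    proof (intro suminf_cong)
      fix k
      have "(lshift ^^ k) -` E \<in> sets borel"
        using measurable_sets[OF measurable_funpow_lshift that, of k] by simp
      then show "(\<integral>\<^sup>+\<omega>. (nn_pull V False ^^ k) H \<omega> * indicator E \<omega> \<partial>\<nu>) =
          emeasure \<rho> ((lshift ^^ k) -` E \<inter> D_set k)"
        by (subst \<rho>_eq) (auto simp: nn_integral_D_set[OF that H])
    qed
    finally show ?thesis .
  qed

  have \<mu>_A: "emeasure \<mu> (A_set (Suc n)) = emeasure \<rho> (D_set n)" for n
  proof -
    have sets_\<rho>: "sets \<rho> = sets borel"
      by (simp add: \<rho>_def weighted_def \<nu>_borel)
    \<comment> \<open>If the first 1 comes n places after j initial zeros, the passage time is n + j
      + 1. The resulting sets are disjoint in j and fill \<open>D_set n\<close> except for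
      \<open>zero_seq\<close>.\<close>
    have "emeasure \<mu> (A_set (Suc n)) = (\<Sum>j. emeasure \<rho> (A_set (Suc (n + j))))"
      by (simp add: \<mu>_eq funpow_lshift_vimage_A_set)
    also have "\<dots> = emeasure \<rho> (\<Union>j. A_set (Suc (n + j)))"
    proof (rule suminf_emeasure)
      show "disjoint_family (\<lambda>j. A_set (Suc (n + j)))"
        by (auto simp: disjoint_family_on_def A_set_def)
    qed (auto simp: sets_\<rho>)
    also have "\<dots> = (\<integral>\<^sup>+\<omega>. H \<omega> * indicator (D_set n - {zero_seq}) \<omega> \<partial>\<nu>)"
      unfolding UN_A_set_eq_D_set[symmetric] by (rule \<rho>_eq) simp
    \<comment> \<open>Restoring \<open>zero_seq\<close> changes nothing, as H vanishes off
      \<open>Omega_star\<close>.\<close>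
    also have "\<dots> = (\<integral>\<^sup>+\<omega>. H \<omega> * indicator (D_set n) \<omega> \<partial>\<nu>)"
      by (intro nn_integral_cong) (auto simp: H_def indicator_def)
    also have "\<dots> = emeasure \<rho> (D_set n)"
      by (rule \<rho>_eq[symmetric]) simp
    finally show ?thesis .
  qed

  show ?thesis
  proof (intro conjI)
    show "\<forall>\<omega>\<in>Omega_star. summable (\<lambda>k. (L0 V ^^ k) h \<omega>)"
      using summable by blast
    show "\<forall>\<omega>\<in>Omega_star. h \<omega> = e \<omega> - L0 V e \<omega> \<and> h \<omega> = L1 V e \<omega>"
      by (simp add: e_L0 e_L1)
    show "\<forall>f. (\<forall>\<omega>\<in>Omega_star. h \<omega> = f \<omega> - L0 V f \<omega> \<and> h \<omega> = L1 V f \<omega>)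
        \<longrightarrow> (\<forall>\<omega>\<in>Omega_star. f \<omega> = e \<omega>)"
      using unique by blast
    show "\<forall>\<omega>\<in>Omega_star. transfer V e \<omega> = e \<omega>"
      using e_transfer by blast
    show "sigma_finite_measure \<mu>"
      unfolding \<mu>_def by (rule sigma_finite_weighted[OF e_measurable])
    show "\<forall>E\<in>sets borel. emeasure \<mu> (lshift -` E) = emeasure \<mu> E"
      unfolding \<mu>_def using weighted_transfer_invariant[OF e_measurable e_nonneg e_transfer] by blast
    show "\<forall>E\<in>sets borel. E \<subseteq> UNIV - {zero_seq} \<longrightarrow>
        emeasure \<mu> E = (\<Sum>k. emeasure \<rho> ((lshift ^^ k) -` E \<inter> D_set k))"
      using \<mu>_eq by blast
    show "\<forall>k\<ge>1. emeasure \<mu> (A_set k) = emeasure \<rho> (D_set (k - 1))"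
    proof (intro allI impI)
      show "emeasure \<mu> (A_set k) = emeasure \<rho> (D_set (k - 1))" if "k \<ge> 1" for k
        using \<mu>_A[of "k - 1"] that by simp
    qed
  qed
qed

end
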